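(* For each integer $n\ge 0$, let $GG_1(n)$ denote the number of partitions of $n$ in which any two parts differ by at least $2$ and no two consecutive even numbers (that is, $2s$ and $2s-2$ for some integer $s$) both appear as parts. Let $\overline{GG_1}(n)$ denote the number of overpartitions of $n$ in which the non-overlined parts are odd and distinct, and the overlined parts are odd and each at most $2r-1$, where $r$ is the number of non-overlined parts. Then $GG_1(n)=\overline{GG_1}(n)$ for every $n\ge 0$.
   Context: A partition of $n$ is a weakly decreasing finite sequence of positive integers (its parts) with sum $n$; parts at different positions count as different parts, so "differ by at least $2$" excludes repeated parts. An overpartition of $n$ is a weakly decreasing finite sequence of positive integers with sum $n$ in which the last occurrence of a part of each given magnitude may or may not be overlined. Thus the overlined parts are automatically distinct from one another. "The non-overlined parts are distinct" means that they are pairwise distinct among themselves; an overlined and a non-overlined part may have the same magnitude. Conditions on parts of a given kind are vacuous if there are no such parts; if $r=0$ the bound $2r-1=-1$ means there are no overlined parts. There is exactly one partition and one overpartition of $0$ (the empty one). *)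

theory Defs imports Main begin

definition is_partition :: "nat \<Rightarrow> nat list \<Rightarrow> bool" where
  "is_partition n xs \<longleftrightarrow>
     sorted_wrt (\<ge>) xs \<and> (\<forall>x\<in>set xs. 0 < x) \<and> sum_list xs = n"

text \<open>A part of an overpartition is a pair of its magnitude and a flag telling whether it is
  overlined.\<close>

type_synonym opart = "nat \<times> bool"

definition is_overpartition :: "nat \<Rightarrow> opart list \<Rightarrow> bool" where
  "is_overpartition n ps \<longleftrightarrow>
     is_partition n (map fst ps) \<and>
     (\<forall>i j. i < j \<longrightarrow> j < length ps \<longrightarrow> snd (ps ! i) \<longrightarrow> fst (ps ! j) \<noteq> fst (ps ! i))"

definition overlined :: "opart list \<Rightarrow> nat list" where
  "overlined ps = map fst (filter snd ps)"

definition non_overlined :: "opart list \<Rightarrow> nat list" where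
  "non_overlined ps = map fst (filter (\<lambda>p. \<not> snd p) ps)"

text \<open>The lists are weakly decreasing, so an earlier entry \<open>x\<close> and a later entry \<open>y\<close> differ by
  at least 2 iff \<open>y + 2 \<le> x\<close>. Consecutive even numbers are written \<open>2 * s\<close>, \<open>2 * s + 2\<close> to avoid
  truncated subtraction; parts being positive, natural \<open>s\<close> suffice.\<close>

definition GG1 :: "nat \<Rightarrow> nat" where
  "GG1 n = card {xs. is_partition n xs \<and>
     sorted_wrt (\<lambda>x y. y + 2 \<le> x) xs \<and>
     \<not> (\<exists>s. 2 * s + 2 \<in> set xs \<and> 2 * s \<in> set xs)}"

text \<open>The bound \<open>2 * r - 1\<close> is taken in the integers, so that it is \<open>-1\<close> for \<open>r = 0\<close>.\<close>

definition GG1_over :: "nat \<Rightarrow> nat" where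
  "GG1_over n = card {ps. is_overpartition n ps \<and>
     (\<forall>x\<in>set (non_overlined ps). odd x) \<and> distinct (non_overlined ps) \<and>
     (\<forall>x\<in>set (overlined ps).
        odd x \<and> int x \<le> 2 * int (length (non_overlined ps)) - 1)}"

text \<open>Since \<^const>\<open>card\<close> of an infinite set is 0, it matters that both counts are taken over
  finite sets.\<close>

lemma length_le_if_is_partition:
  assumes "is_partition n xs" shows "length xs \<le> n"
proof -
  have "length xs \<le> sum_list xs" if "\<forall>x\<in>set xs. 0 < x" for xs :: "nat list"
    using that by (induction xs) auto
  then show ?thesis using assms by (auto simp: is_partition_def)
qed

lemma finite_partitions: "finite {xs. is_partition n xs}"
proof (rule finite_subset)
  show "{xs. is_partition n xs} \<subseteq> {xs. set xs \<subseteq> {..n} \<and> length xs \<le> n}"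
    using length_le_if_is_partition by (auto simp: is_partition_def member_le_sum_list)
qed (simp add: finite_lists_length_le)

lemma finite_overpartitions: "finite {ps. is_overpartition n ps}"
proof (rule finite_subset)
  show "{ps. is_overpartition n ps} \<subseteq> {ps. set ps \<subseteq> {..n} \<times> UNIV \<and> length ps \<le> n}"
  proof safe
    fix ps assume ps: "is_overpartition n ps"
    then have p: "is_partition n (map fst ps)" by (simp add: is_overpartition_def)
    show "length ps \<le> n" using length_le_if_is_partition[OF p] by simp
    fix m b assume "(m, b) \<in> set ps"
    then have "m \<in> set (map fst ps)" by force
    then show "m \<le> n" using p member_le_sum_list unfolding is_partition_def by blast
  qed simp
qed (simp add: finite_lists_length_le)

end

theory Submission imports Defs begin

text \<open>
  Both kinds of objects carry a second statistic \<open>r\<close> that refines the weight \<open>n\<close>: the number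
  of parts of a partition, and the number of non-overlined parts of an overpartition. The
  numbers of objects of weight \<open>n\<close> and grade \<open>r\<close> already agree, because their generating
  functions \<open>G\<^sub>r(q)\<close> in \<open>n\<close> satisfy the same recurrence
  \<open>G\<^sub>r = q\<^bsup>2r\<^esup> G\<^sub>r + q\<^bsup>2r-1\<^esup> G\<^bsub>r-1\<^esub> + q\<^bsup>4r-2\<^esup> G\<^bsub>r-1\<^esub>\<close>, that is,
  \<open>(1 - q\<^bsup>2r\<^esup>) G\<^sub>r = q\<^bsup>2r-1\<^esup> (1 + q\<^bsup>2r-1\<^esup>) G\<^bsub>r-1\<^esub>\<close>, with \<open>G\<^sub>0 = 1\<close>.

  For a partition with \<open>r\<close> parts as counted by \<open>GG1\<close>, look at the smallest part. If it is at
  least 3, subtract 2 from all the parts. If it is 1, the other parts are at least 3; remove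
  the 1 and subtract 2 from the others, for a loss of \<open>1 + 2(r - 1)\<close>. If it is 2, then 4 is
  excluded, so the other parts are at least 5; remove the 2 and subtract 4 from the others,
  for a loss of \<open>2 + 4(r - 1)\<close>. Even shifts preserve all the conditions.

  An overpartition as counted by \<open>GG1_over\<close> is determined by the set \<open>A\<close> of its non-overlined
  parts and the set \<open>B\<close> of its overlined parts, which is any set of odd numbers below \<open>2r\<close>,
  where \<open>r = |A|\<close>. If \<open>1 \<notin> A\<close>, subtract 2 from all of \<open>A\<close>. Otherwise remove 1 from \<open>A\<close> and
  subtract 2 from the rest, again for a loss of \<open>2r - 1\<close>; the bound on \<open>B\<close> decreases by 2, so
  the element \<open>2r - 1\<close> has to be removed from \<open>B\<close> if it is there, for a further loss of
  \<open>2r - 1\<close>.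

  The recurrence is solved once and for all in \<open>card_weight_fibre_eq_gg_count\<close>, which applies
  to any graded family that splits into three such pieces; \<open>gg_lists_Suc\<close> and
  \<open>odd_set_pairs_Suc\<close> are the two splittings.
\<close>

section \<open>The common recurrence\<close>

text \<open>The coefficient of \<open>q\<^sup>n\<close> in \<open>G\<^sub>r\<close>, with the recurrence written for \<open>r = k + 1\<close>. The first
  summand keeps the grade and lowers the weight; this is what makes the recursion terminate.\<close>

fun gg_count :: "nat \<Rightarrow> nat \<Rightarrow> nat" where
  "gg_count 0 n = (if n = 0 then 1 else 0)"
| "gg_count (Suc k) n =
     (if 2 * k + 2 \<le> n then gg_count (Suc k) (n - (2 * k + 2)) else 0) +
     (if 2 * k + 1 \<le> n then gg_count k (n - (2 * k + 1)) else 0) +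
     (if 4 * k + 2 \<le> n then gg_count k (n - (4 * k + 2)) else 0)"

lemma weight_fibre_image:
  fixes w :: "'a \<Rightarrow> nat"
  assumes "\<And>x. x \<in> X \<Longrightarrow> w (f x) = w x + c"
  shows "{y \<in> f ` X. w y = n} = (if c \<le> n then f ` {x \<in> X. w x = n - c} else {})"
  using assms by force

lemma card_weight_fibre_image:
  fixes w :: "'a \<Rightarrow> nat"
  assumes "\<And>x. x \<in> X \<Longrightarrow> w (f x) = w x + c" and "inj_on f X"
    and "c \<le> n \<Longrightarrow> finite {x \<in> X. w x = n - c} \<and> card {x \<in> X. w x = n - c} = m"
  shows "finite {y \<in> f ` X. w y = n} \<and>
    card {y \<in> f ` X. w y = n} = (if c \<le> n then m else 0)"
proof -
  have "inj_on f {x \<in> X. w x = n - c}"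
    using assms(2) by (rule inj_on_subset) auto
  then show ?thesis
    using assms(3) by (simp add: weight_fibre_image[of X w f c, OF assms(1)] card_image)
qed

text \<open>The decomposition of grade \<open>k + 1\<close> is self-referential: \<open>s\<close> maps that grade into itself.
  Since \<open>s\<close> raises the weight, the fibres of the weight are nevertheless determined. Finiteness
  of the fibres is part of the conclusion because the cardinality of a disjoint union can only
  be computed for finite sets.\<close>

lemma card_weight_fibre_eq_gg_count:
  fixes X :: "nat \<Rightarrow> 'a set" and w :: "'a \<Rightarrow> nat"
  assumes zero: "X 0 = {e}" "w e = 0"
    and split: "\<And>k. X (Suc k) = s ` X (Suc k) \<union> a k ` X k \<union> b k ` X k"
    and disj: "\<And>k. s ` X (Suc k) \<inter> a k ` X k = {}" "\<And>k. s ` X (Suc k) \<inter> b k ` X k = {}"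
      "\<And>k. a k ` X k \<inter> b k ` X k = {}"
    and inj: "\<And>k. inj_on s (X (Suc k))" "\<And>k. inj_on (a k) (X k)" "\<And>k. inj_on (b k) (X k)"
    and weight: "\<And>k x. x \<in> X (Suc k) \<Longrightarrow> w (s x) = w x + (2 * k + 2)"
      "\<And>k x. x \<in> X k \<Longrightarrow> w (a k x) = w x + (2 * k + 1)"
      "\<And>k x. x \<in> X k \<Longrightarrow> w (b k x) = w x + (4 * k + 2)"
  shows "finite {x \<in> X r. w x = n} \<and> card {x \<in> X r. w x = n} = gg_count r n"
proof (induction r n rule: gg_count.induct)
  case (1 n)
  have "{x \<in> X 0. w x = n} = (if n = 0 then {e} else {})" using zero by auto
  then show ?case by simp
next
  case (2 k n)
  let ?S = "{y \<in> s ` X (Suc k). w y = n}"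
  let ?A = "{y \<in> a k ` X k. w y = n}"
  let ?B = "{y \<in> b k ` X k. w y = n}"
  note S = card_weight_fibre_image[OF weight(1) inj(1) 2(1)]
  note A = card_weight_fibre_image[OF weight(2) inj(2) 2(2)]
  note B = card_weight_fibre_image[OF weight(3) inj(3) 2(3)]
  have "{x \<in> X (Suc k). w x = n} = ?S \<union> ?A \<union> ?B" by (subst split) blast
  moreover have "?S \<inter> ?A = {}" "(?S \<union> ?A) \<inter> ?B = {}"
    using disj[of k] by blast+
  ultimately show ?case using S A B by (simp add: card_Un_disjoint)
qed

lemma card_eq_sum_fibres:
  fixes f :: "'a \<Rightarrow> nat"
  assumes "finite S" "\<And>x. x \<in> S \<Longrightarrow> f x \<le> n"
  shows "card S = (\<Sum>r\<le>n. card {x \<in> S. f x = r})"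
proof -
  have "S = (\<Union>r\<in>{..n}. {x \<in> S. f x = r})" using assms(2) by auto
  then have "card S = card (\<Union>r\<in>{..n}. {x \<in> S. f x = r})" by simp
  also have "\<dots> = (\<Sum>r\<le>n. card {x \<in> S. f x = r})"
    by (rule card_UN_disjoint) (use assms(1) in auto)
  finally show ?thesis .
qed

section \<open>Partitions without consecutive even parts\<close>

text \<open>The two conditions on the parts in \<open>GG1\<close> are one condition on pairs of parts, so that the
  simplification rules for \<^const>\<open>sorted_wrt\<close> handle both.\<close>

definition gg_gap :: "nat \<Rightarrow> nat \<Rightarrow> bool" where
  "gg_gap x y \<longleftrightarrow> y + 2 \<le> x \<and> \<not> (even y \<and> x = y + 2)"

definition gg_lists :: "nat \<Rightarrow> nat list set" where
  "gg_lists r = {xs. length xs = r \<and> sorted_wrt gg_gap xs \<and> (\<forall>x\<in>set xs. 0 < x)}"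

lemma sorted_wrt_gg_gap_iff:
  "sorted_wrt gg_gap xs \<longleftrightarrow> sorted_wrt (\<lambda>x y. y + 2 \<le> x) xs \<and>
     \<not> (\<exists>s. 2 * s + 2 \<in> set xs \<and> 2 * s \<in> set xs)"
proof (induction xs)
  case (Cons x xs)
  have "(\<forall>y\<in>set xs. \<not> (even y \<and> x = y + 2)) \<longleftrightarrow> \<not> (\<exists>s. x = 2 * s + 2 \<and> 2 * s \<in> set xs)"
    by (auto simp: dvd_def)
  moreover have "\<not> (\<exists>s. 2 * s + 2 \<in> set xs \<and> x = 2 * s)" if "\<forall>y\<in>set xs. y + 2 \<le> x"
    using that by fastforce
  ultimately show ?case using Cons unfolding gg_gap_def by auto
qed simp

lemma gg_gap_add_even: "even c \<Longrightarrow> gg_gap (x + c) (y + c) \<longleftrightarrow> gg_gap x y"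
  by (auto simp: gg_gap_def)

lemma sorted_wrt_gg_gap_map_add:
  "even c \<Longrightarrow> sorted_wrt gg_gap (map (\<lambda>x. x + c) xs) \<longleftrightarrow> sorted_wrt gg_gap xs"
  by (simp add: sorted_wrt_map gg_gap_add_even)

lemma eq_map_add:
  fixes ys :: "nat list"
  assumes "\<forall>y\<in>set ys. c < y"
  obtains xs where "ys = map (\<lambda>x. x + c) xs" "\<forall>x\<in>set xs. 0 < x"
proof
  show "ys = map (\<lambda>x. x + c) (map (\<lambda>y. y - c) ys)"
    using assms by (induction ys) auto
  show "\<forall>x\<in>set (map (\<lambda>y. y - c) ys). 0 < x" using assms by auto
qed

text \<open>The three pieces are the lists with last entry at least 3, equal to 1, and equal to 2. In
  the last one the shift is by 4 because the entry before 2 can be neither 3 nor 4.\<close>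

lemma gg_lists_Suc:
  "gg_lists (Suc k) = map (\<lambda>x. x + 2) ` gg_lists (Suc k)
     \<union> (\<lambda>xs. map (\<lambda>x. x + 2) xs @ [1]) ` gg_lists k
     \<union> (\<lambda>xs. map (\<lambda>x. x + 4) xs @ [2]) ` gg_lists k" (is "_ = ?S \<union> ?A \<union> ?B")
proof (intro equalityI subsetI)
  fix zs assume "zs \<in> gg_lists (Suc k)"
  then have zs: "length zs = Suc k" "sorted_wrt gg_gap zs" "\<forall>x\<in>set zs. 0 < x"
    by (auto simp: gg_lists_def)
  from zs(1) obtain ys z where zs_eq: "zs = ys @ [z]" by (metis length_Suc_conv_rev)
  have ys: "sorted_wrt gg_gap ys" "\<forall>y\<in>set ys. gg_gap y z" "length ys = k" "0 < z"
    using zs unfolding zs_eq by (auto simp: sorted_wrt_append)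
  consider "z = 1" | "z = 2" | "2 < z" using ys(4) by linarith
  then show "zs \<in> ?S \<union> ?A \<union> ?B"
  proof cases
    case 1
    have "\<forall>y\<in>set ys. 2 < y" using ys(2) 1 by (auto simp: gg_gap_def)
    then obtain xs where xs: "ys = map (\<lambda>x. x + 2) xs" "\<forall>x\<in>set xs. 0 < x"
      by (rule eq_map_add)
    then have "xs \<in> gg_lists k"
      using ys by (simp add: gg_lists_def sorted_wrt_gg_gap_map_add del: add_2_eq_Suc')
    then show ?thesis using xs zs_eq 1 by blast
  next
    case 2
    have "\<forall>y\<in>set ys. 4 < y" using ys(2) 2 by (auto simp: gg_gap_def)
    then obtain xs where xs: "ys = map (\<lambda>x. x + 4) xs" "\<forall>x\<in>set xs. 0 < x"
      by (rule eq_map_add)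
    then have "xs \<in> gg_lists k"
      using ys by (simp add: gg_lists_def sorted_wrt_gg_gap_map_add)
    then show ?thesis using xs zs_eq 2 by blast
  next
    case 3
    have "\<forall>y\<in>set zs. 2 < y" using ys(2) 3 zs_eq by (auto simp: gg_gap_def)
    then obtain xs where xs: "zs = map (\<lambda>x. x + 2) xs" "\<forall>x\<in>set xs. 0 < x"
      by (rule eq_map_add)
    then have "xs \<in> gg_lists (Suc k)"
      using zs by (simp add: gg_lists_def sorted_wrt_gg_gap_map_add del: add_2_eq_Suc')
    then show ?thesis using xs by blast
  qed
next
  fix zs assume "zs \<in> ?S \<union> ?A \<union> ?B"
  then show "zs \<in> gg_lists (Suc k)"
    by (auto simp: gg_lists_def sorted_wrt_append sorted_wrt_gg_gap_map_add gg_gap_def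
        Suc_le_eq simp del: add_2_eq_Suc')
qed

lemma sum_list_map_add: "sum_list (map (\<lambda>x. x + c) xs) = sum_list xs + c * length (xs :: nat list)"
  by (induction xs) auto

lemma card_gg_lists: "card {xs \<in> gg_lists r. sum_list xs = n} = gg_count r n"
proof -
  have "finite {xs \<in> gg_lists r. sum_list xs = n} \<and>
      card {xs \<in> gg_lists r. sum_list xs = n} = gg_count r n"
  proof (rule card_weight_fibre_eq_gg_count[where e = "[]" and s = "map (\<lambda>x. x + 2)"
        and a = "\<lambda>k xs. map (\<lambda>x. x + 2) xs @ [1]" and b = "\<lambda>k xs. map (\<lambda>x. x + 4) xs @ [2]"])
    fix k
    show "map (\<lambda>x. x + 2) ` gg_lists (Suc k) \<inter> (\<lambda>xs. map (\<lambda>x. x + 2) xs @ [1]) ` gg_lists k = {}"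
      by (auto simp: map_eq_append_conv)
    \<comment> \<open>A last entry 2 on the left would come from a part 0.\<close>
    show "map (\<lambda>x. x + 2) ` gg_lists (Suc k) \<inter> (\<lambda>xs. map (\<lambda>x. x + 4) xs @ [2]) ` gg_lists k = {}"
      by (auto simp: map_eq_append_conv append_eq_map_conv gg_lists_def)
    show "(\<lambda>xs. map (\<lambda>x. x + 2) xs @ [1]) ` gg_lists k \<inter>
        (\<lambda>xs. map (\<lambda>x. x + 4) xs @ [2]) ` gg_lists k = {}"
      by auto
    show "gg_lists (Suc k) = map (\<lambda>x. x + 2) ` gg_lists (Suc k) \<union>
        (\<lambda>xs. map (\<lambda>x. x + 2) xs @ [1]) ` gg_lists k \<union>
        (\<lambda>xs. map (\<lambda>x. x + 4) xs @ [2]) ` gg_lists k"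
      by (rule gg_lists_Suc)
  qed (auto simp: gg_lists_def sum_list_map_add inj_on_def simp del: add_2_eq_Suc')
  then show ?thesis ..
qed

lemma GG1_eq_sum: "GG1 n = (\<Sum>r\<le>n. gg_count r n)"
proof -
  let ?S = "{xs. is_partition n xs \<and> sorted_wrt gg_gap xs}"
  have "GG1 n = card ?S"
    by (simp add: GG1_def sorted_wrt_gg_gap_iff)
  also have "\<dots> = (\<Sum>r\<le>n. card {xs \<in> ?S. length xs = r})"
    by (rule card_eq_sum_fibres) (auto simp: length_le_if_is_partition finite_partitions)
  also have "\<dots> = (\<Sum>r\<le>n. card {xs \<in> gg_lists r. sum_list xs = n})"
  proof -
    have "sorted_wrt (\<ge>) xs" if "sorted_wrt gg_gap xs" for xs
      using that by (rule sorted_wrt_mono_rel[rotated]) (simp add: gg_gap_def)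
    then have "{xs \<in> ?S. length xs = r} = {xs \<in> gg_lists r. sum_list xs = n}" for r
      by (auto simp: is_partition_def gg_lists_def)
    then show ?thesis by simp
  qed
  finally show ?thesis by (simp add: card_gg_lists)
qed

section \<open>Pairs of sets of odd numbers\<close>

definition odd_set_pairs :: "nat \<Rightarrow> (nat set \<times> nat set) set" where
  "odd_set_pairs r = {(A, B). finite A \<and> card A = r \<and> (\<forall>x\<in>A. odd x) \<and>
     (\<forall>x\<in>B. odd x \<and> x < 2 * r)}"

definition pair_sum :: "nat set \<times> nat set \<Rightarrow> nat" where
  "pair_sum p = \<Sum> (fst p) + \<Sum> (snd p)"

lemma mem_odd_set_pairs_iff:
  "(A, B) \<in> odd_set_pairs r \<longleftrightarrow> finite A \<and> card A = r \<and> (\<forall>x\<in>A. odd x) \<and>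
     (\<forall>x\<in>B. odd x \<and> x < 2 * r)"
  unfolding odd_set_pairs_def mem_Collect_eq prod.case ..

lemma odd_set_pairs_finite:
  assumes "(A, B) \<in> odd_set_pairs r" shows "finite A" "finite B"
proof -
  have "B \<subseteq> {..<2 * r}" using assms by (auto simp: mem_odd_set_pairs_iff)
  then show "finite B" by (rule finite_subset) simp
qed (use assms in \<open>simp add: mem_odd_set_pairs_iff\<close>)

lemma odd_set_pairs_0: "odd_set_pairs 0 = {({}, {})}"
proof -
  have "(A, B) \<in> odd_set_pairs 0 \<longleftrightarrow> A = {} \<and> B = {}" for A B
  proof
    assume "(A, B) \<in> odd_set_pairs 0"
    then have "finite A" "card A = 0" "\<forall>x\<in>B. x < 2 * 0"
      unfolding mem_odd_set_pairs_iff by blast+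
    then show "A = {} \<and> B = {}" by (metis card_0_eq ex_in_conv mult_0_right not_less_zero)
  next
    assume "A = {} \<and> B = {}"
    then show "(A, B) \<in> odd_set_pairs 0" by (simp only: mem_odd_set_pairs_iff) simp
  qed
  then show ?thesis by (intro set_eqI) (metis old.prod.exhaust prod.inject singleton_iff)
qed

definition shift :: "nat set \<Rightarrow> nat set" where
  "shift A = (\<lambda>x. x + 2) ` A"

lemma inj_shift: "inj shift"
  unfolding shift_def by (rule injI) (simp add: inj_image_eq_iff inj_def)

lemma finite_shift_iff: "finite (shift A) \<longleftrightarrow> finite A"
  by (simp add: shift_def finite_image_iff inj_on_def)

lemma card_shift: "card (shift A) = card A"
  by (simp add: shift_def card_image inj_on_def)

lemma sum_shift: "\<Sum> (shift A) = \<Sum> A + 2 * card A"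
  unfolding shift_def
  by (simp add: sum.reindex inj_on_def sum.distrib mult.commute del: add_2_eq_Suc')

lemma one_notin_shift: "1 \<notin> shift A"
  by (auto simp: shift_def)

lemma odd_shift_iff: "(\<forall>x\<in>shift A. odd x) \<longleftrightarrow> (\<forall>x\<in>A. odd x)"
  by (simp add: shift_def)

lemma odd_set_eq_shift:
  assumes "\<forall>x\<in>A. odd x" "1 \<notin> A"
  obtains C where "A = shift C"
proof
  have "x - 2 + 2 = x" if "x \<in> A" for x
  proof -
    have "odd x" "x \<noteq> 1" using that assms by auto
    then show ?thesis by presburger
  qed
  then show "A = shift ((\<lambda>x. x - 2) ` A)"
    by (simp add: shift_def image_image del: add_2_eq_Suc')
qed

text \<open>The first piece consists of the pairs with \<open>1 \<notin> A\<close>. When \<open>1 \<in> A\<close>, the pair is in the second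
  or third piece according to whether \<open>B\<close> contains \<open>2 * k + 1\<close>, the largest number that it may
  contain in grade \<open>k + 1\<close> and the only one that is too large in grade \<open>k\<close>.\<close>

lemma odd_set_pairs_Suc:
  "odd_set_pairs (Suc k) = map_prod shift id ` odd_set_pairs (Suc k)
     \<union> map_prod (\<lambda>A. insert 1 (shift A)) id ` odd_set_pairs k
     \<union> map_prod (\<lambda>A. insert 1 (shift A)) (insert (2 * k + 1)) ` odd_set_pairs k"
  (is "_ = ?S \<union> ?A \<union> ?B")
proof (intro equalityI subsetI)
  fix p assume "p \<in> odd_set_pairs (Suc k)"
  then obtain A B where p: "p = (A, B)" and A: "finite A" "card A = Suc k" "\<forall>x\<in>A. odd x"
    and B: "\<forall>x\<in>B. odd x \<and> x < 2 * Suc k"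
    by (cases p) (auto simp: mem_odd_set_pairs_iff)
  show "p \<in> ?S \<union> ?A \<union> ?B"
  proof (cases "1 \<in> A")
    case False
    then obtain C where C: "A = shift C"
      using odd_set_eq_shift A(3) by blast
    then have "(C, B) \<in> odd_set_pairs (Suc k)"
      using A B by (simp add: mem_odd_set_pairs_iff finite_shift_iff card_shift odd_shift_iff)
    then have "map_prod shift id (C, B) \<in> ?S" by (rule imageI)
    then show ?thesis using p C by simp
  next
    case True
    obtain C where C: "A - {1} = shift C"
      using odd_set_eq_shift[of "A - {1}"] A(3) by blast
    have A_eq: "A = insert 1 (shift C)" using C True by blast
    have "finite C" "card C = k" "\<forall>x\<in>C. odd x"
      using A one_notin_shift[of C] unfolding A_eq
      by (simp_all add: finite_shift_iff card_shift odd_shift_iff)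
    moreover have "x < 2 * k" if "x \<in> B - {2 * k + 1}" for x
    proof -
      have "odd x" "x < 2 * k + 2" "x \<noteq> 2 * k + 1" using that B by auto
      then show ?thesis by presburger
    qed
    ultimately have C': "(C, B - {2 * k + 1}) \<in> odd_set_pairs k"
      using B unfolding mem_odd_set_pairs_iff by blast
    show ?thesis
    proof (cases "2 * k + 1 \<in> B")
      case True
      then have "p = map_prod (\<lambda>A. insert 1 (shift A)) (insert (2 * k + 1)) (C, B - {2 * k + 1})"
        using p A_eq by auto
      then show ?thesis using C' by blast
    next
      case False
      then have "p = map_prod (\<lambda>A. insert 1 (shift A)) id (C, B - {2 * k + 1})"
        using p A_eq by auto
      then show ?thesis using C' by blast
    qed
  qed
next
  have 1: "(shift A, B) \<in> odd_set_pairs (Suc k)" if "(A, B) \<in> odd_set_pairs (Suc k)" for A B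
    using that by (simp add: mem_odd_set_pairs_iff finite_shift_iff card_shift odd_shift_iff)
  have 2: "(insert 1 (shift A), B') \<in> odd_set_pairs (Suc k)"
    if "(A, B) \<in> odd_set_pairs k" "B' \<subseteq> insert (2 * k + 1) B" for A B B'
  proof -
    have A: "finite A" "card A = k" "\<forall>x\<in>A. odd x" and B: "\<forall>x\<in>B. odd x \<and> x < 2 * k"
      using that(1) by (auto simp: mem_odd_set_pairs_iff)
    have "card (insert 1 (shift A)) = Suc k"
      using A(1,2) one_notin_shift[of A] by (simp add: finite_shift_iff card_shift)
    moreover have "\<forall>x\<in>B'. odd x \<and> x < 2 * Suc k" using B that(2) by fastforce
    ultimately show ?thesis using A by (simp add: mem_odd_set_pairs_iff finite_shift_iff odd_shift_iff)
  qed
  fix p assume "p \<in> ?S \<union> ?A \<union> ?B"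
  then show "p \<in> odd_set_pairs (Suc k)"
    using 1 2[OF _ subset_insertI] 2[OF _ subset_refl]
    by (elim UnE imageE) (auto simp del: One_nat_def)
qed

lemma card_odd_set_pairs: "card {p \<in> odd_set_pairs r. pair_sum p = n} = gg_count r n"
proof -
  let ?s = "map_prod shift id :: _ \<Rightarrow> nat set \<times> nat set"
  let ?a = "map_prod (\<lambda>A. insert 1 (shift A)) id :: _ \<Rightarrow> nat set \<times> nat set"
  let ?b = "\<lambda>k. map_prod (\<lambda>A. insert 1 (shift A)) (insert (2 * k + 1))"
  have notin: "2 * k + 1 \<notin> B" if "(A, B) \<in> odd_set_pairs k" for A B k
  proof
    assume "2 * k + 1 \<in> B"
    then have "2 * k + 1 < 2 * k" using that unfolding mem_odd_set_pairs_iff by blast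
    then show False by simp
  qed
  have insert_shift: "insert 1 (shift A) = insert 1 (shift A') \<longleftrightarrow> A = A'" for A A'
    by (metis one_notin_shift insert_ident inj_shift injD)
  have "finite {p \<in> odd_set_pairs r. pair_sum p = n} \<and>
      card {p \<in> odd_set_pairs r. pair_sum p = n} = gg_count r n"
  proof (rule card_weight_fibre_eq_gg_count[where X = odd_set_pairs and w = pair_sum
        and e = "({}, {})" and s = ?s and a = "\<lambda>k. ?a" and b = ?b])
    show "odd_set_pairs 0 = {({}, {})}" by (rule odd_set_pairs_0)
    show "pair_sum ({}, {}) = 0" by (simp add: pair_sum_def)
    fix k
    show "odd_set_pairs (Suc k) = ?s ` odd_set_pairs (Suc k) \<union> ?a ` odd_set_pairs k
        \<union> ?b k ` odd_set_pairs k"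
      by (rule odd_set_pairs_Suc)
    have ne: "shift A \<noteq> insert 1 C" for A C using one_notin_shift[of A] by auto
    then show "?s ` odd_set_pairs (Suc k) \<inter> ?a ` odd_set_pairs k = {}"
        "?s ` odd_set_pairs (Suc k) \<inter> ?b k ` odd_set_pairs k = {}"
      by (auto simp del: One_nat_def)
    show "?a ` odd_set_pairs k \<inter> ?b k ` odd_set_pairs k = {}"
      by (auto simp del: One_nat_def) (metis insertI1 notin)
    show "inj_on ?s (odd_set_pairs (Suc k))"
      by (auto simp: inj_on_def dest: injD[OF inj_shift])
    show "inj_on ?a (odd_set_pairs k)"
      by (rule inj_onI) (auto simp: insert_shift simp del: One_nat_def)
    show "inj_on (?b k) (odd_set_pairs k)"
    proof (rule inj_onI)
      fix p q
      assume "p \<in> odd_set_pairs k" "q \<in> odd_set_pairs k" "?b k p = ?b k q"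
      moreover obtain A B A' B' where pq: "p = (A, B)" "q = (A', B')" by fastforce
      ultimately have *: "(A, B) \<in> odd_set_pairs k" "(A', B') \<in> odd_set_pairs k"
        "?b k (A, B) = ?b k (A', B')" by simp_all
      then have "insert 1 (shift A) = insert 1 (shift A')"
        "insert (2 * k + 1) B = insert (2 * k + 1) B'" by auto
      then show "p = q"
        using notin[OF *(1)] notin[OF *(2)] unfolding pq insert_shift by (metis insert_ident)
    qed
    fix p :: "nat set \<times> nat set"
    obtain A B where p: "p = (A, B)" by (cases p)
    show "pair_sum (?s p) = pair_sum p + (2 * k + 2)" if "p \<in> odd_set_pairs (Suc k)"
      using that unfolding p by (auto simp: pair_sum_def sum_shift mem_odd_set_pairs_iff)
    assume mem: "p \<in> odd_set_pairs k"
    have "finite A" "finite B" "2 * k + 1 \<notin> B"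
      using mem odd_set_pairs_finite notin unfolding p by blast+
    moreover have "card A = k" using mem unfolding p mem_odd_set_pairs_iff by blast
    ultimately show "pair_sum (?a p) = pair_sum p + (2 * k + 1)"
        "pair_sum (?b k p) = pair_sum p + (4 * k + 2)"
      using one_notin_shift[of A] unfolding p
      by (simp_all add: pair_sum_def sum_shift finite_shift_iff)
  qed
  then show ?thesis ..
qed

section \<open>Overpartitions as pairs of sets\<close>

text \<open>Pulling back along the injection \<open>f\<close> reduces this to the fact that a finite subset of a
  linear order has exactly one strictly increasing enumeration.\<close>

lemma bij_betw_strictly_decreasing_lists:
  fixes f :: "'a \<Rightarrow> 'b :: linorder"
  assumes "inj f"
  shows "bij_betw set {xs. sorted_wrt (\<lambda>x y. f y < f x) xs} {A. finite A}"
proof (rule bij_betw_imageI)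
  have key: "sorted_wrt (<) (rev (map f xs)) \<longleftrightarrow> sorted_wrt (\<lambda>x y. f y < f x) xs" for xs
    by (simp add: sorted_wrt_rev sorted_wrt_map)
  show "inj_on set {xs. sorted_wrt (\<lambda>x y. f y < f x) xs}"
  proof (rule inj_onI)
    fix xs ys
    assume xs: "xs \<in> {xs. sorted_wrt (\<lambda>x y. f y < f x) xs}"
      and ys: "ys \<in> {xs. sorted_wrt (\<lambda>x y. f y < f x) xs}" and eq: "set xs = set ys"
    have "rev (map f xs) = rev (map f ys)"
      by (rule strict_sorted_equal) (use xs ys eq in \<open>simp_all only: key mem_Collect_eq set_rev set_map\<close>)
    then show "xs = ys" using assms by (simp add: inj_map_eq_map)
  qed
  show "set ` {xs. sorted_wrt (\<lambda>x y. f y < f x) xs} = {A. finite A}"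
  proof (intro equalityI subsetI)
    fix A :: "'a set" assume "A \<in> {A. finite A}"
    define ks where "ks = rev (sorted_list_of_set (f ` A))"
    have ks: "set ks = f ` A" "sorted_wrt (<) (rev ks)"
      using \<open>A \<in> _\<close> by (auto simp: ks_def)
    have inv: "map f (map (inv f) ks) = ks"
      using ks(1) by (auto intro!: map_idI simp: f_inv_into_f)
    have "sorted_wrt (\<lambda>x y. f y < f x) (map (inv f) ks)"
      using ks(2) key[of "map (inv f) ks"] inv by simp
    moreover have "set (map (inv f) ks) = A"
      using ks(1) assms by (simp add: image_image)
    ultimately show "A \<in> set ` {xs. sorted_wrt (\<lambda>x y. f y < f x) xs}" by blast
  qed auto
qed

text \<open>The order in which the parts are listed: by decreasing magnitude, with an overlined part
  after a non-overlined one of the same magnitude.\<close>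

definition opart_key :: "opart \<Rightarrow> nat" where
  "opart_key p = 2 * fst p + (if snd p then 0 else 1)"

lemma inj_opart_key: "inj opart_key"
  by (rule injI) (auto simp: opart_key_def prod_eq_iff split: if_splits; presburger)

text \<open>Once the non-overlined parts are distinct, a magnitude occurs at most twice, and if it
  does, then first without and then with an overline. Thus the ordering condition on
  overpartitions becomes a strict ordering, and the list is determined by its set of entries.\<close>

lemma overpartition_sorted_iff:
  "sorted_wrt (\<ge>) (map fst ps) \<and>
   (\<forall>i j. i < j \<longrightarrow> j < length ps \<longrightarrow> snd (ps ! i) \<longrightarrow> fst (ps ! j) \<noteq> fst (ps ! i)) \<and>
   distinct (non_overlined ps) \<longleftrightarrow> sorted_wrt (\<lambda>p q. opart_key q < opart_key p) ps"
proof -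
  have "(\<forall>i j. i < j \<longrightarrow> j < length ps \<longrightarrow> snd (ps ! i) \<longrightarrow> fst (ps ! j) \<noteq> fst (ps ! i)) \<longleftrightarrow>
      sorted_wrt (\<lambda>p q. snd p \<longrightarrow> fst q \<noteq> fst p) ps"
    by (auto simp: sorted_wrt_iff_nth_less)
  moreover have "sorted_wrt (\<ge>) (map fst ps) \<and> sorted_wrt (\<lambda>p q. snd p \<longrightarrow> fst q \<noteq> fst p) ps \<and>
      distinct (non_overlined ps) \<longleftrightarrow> sorted_wrt (\<lambda>p q. opart_key q < opart_key p) ps"
  proof (induction ps)
    case (Cons p ps)
    have "opart_key q < opart_key p \<longleftrightarrow> fst q \<le> fst p \<and> (snd p \<longrightarrow> fst q \<noteq> fst p) \<and>
        (\<not> snd p \<longrightarrow> \<not> snd q \<longrightarrow> fst q \<noteq> fst p)" for q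
      by (auto simp: opart_key_def)
    moreover have "x \<in> set (non_overlined ps) \<longleftrightarrow> (\<exists>q\<in>set ps. \<not> snd q \<and> fst q = x)" for x
      unfolding non_overlined_def set_map set_filter by blast
    then have "distinct (non_overlined (p # ps)) \<longleftrightarrow> distinct (non_overlined ps) \<and>
        (\<not> snd p \<longrightarrow> (\<forall>q\<in>set ps. \<not> snd q \<longrightarrow> fst q \<noteq> fst p))"
      by (cases "snd p") (auto simp: non_overlined_def[of "p # ps"] simp flip: non_overlined_def[of ps])
    ultimately show ?case using Cons.IH by auto
  qed (simp add: non_overlined_def)
  ultimately show ?thesis by simp
qed

definition magnitude_sets :: "opart set \<Rightarrow> nat set \<times> nat set" where
  "magnitude_sets C = ({m. (m, False) \<in> C}, {m. (m, True) \<in> C})"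

lemma magnitude_sets_set: "magnitude_sets (set ps) = (set (non_overlined ps), set (overlined ps))"
  by (force simp: magnitude_sets_def non_overlined_def overlined_def)

lemma bij_betw_magnitude_sets:
  "bij_betw magnitude_sets {C. finite C} {(A, B). finite A \<and> finite B}"
proof (rule bij_betw_byWitness[where f' = "\<lambda>(A, B). A \<times> {False} \<union> B \<times> {True}"])
  show "\<forall>C\<in>{C. finite C}. (\<lambda>(A, B). A \<times> {False} \<union> B \<times> {True}) (magnitude_sets C) = C"
    by (auto simp: magnitude_sets_def) (metis (full_types))+
  show "magnitude_sets ` {C. finite C} \<subseteq> {(A, B). finite A \<and> finite B}"
  proof safe
    fix C A B assume C: "finite C" "(A, B) = magnitude_sets C"
    have "A \<subseteq> fst ` C" "B \<subseteq> fst ` C" using C(2) by (force simp: magnitude_sets_def)+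
    then show "finite A" "finite B" using C(1) by (meson finite_imageI finite_subset)+
  qed
qed (auto simp: magnitude_sets_def)

lemma sum_list_map_fst:
  "sum_list (map fst ps) = sum_list (non_overlined ps) + sum_list (overlined ps)"
  by (induction ps) (auto simp: non_overlined_def overlined_def)

text \<open>On lists that are strictly decreasing with respect to \<open>opart_key\<close>, the conditions defining
  \<open>GG1_over\<close> say that the pair of sets belongs to \<open>odd_set_pairs\<close>. Positivity of the parts
  follows from their being odd.\<close>

lemma GG1_over_eq_sum: "GG1_over n = (\<Sum>r\<le>n. gg_count r n)"
proof -
  let ?cond = "\<lambda>ps. is_overpartition n ps \<and>
     (\<forall>x\<in>set (non_overlined ps). odd x) \<and> distinct (non_overlined ps) \<and>
     (\<forall>x\<in>set (overlined ps). odd x \<and> int x \<le> 2 * int (length (non_overlined ps)) - 1)"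
  let ?S = "Collect ?cond"
  let ?L = "{ps. sorted_wrt (\<lambda>p q. opart_key q < opart_key p) ps}"
  let ?P = "{(A, B). finite A \<and> finite B} :: (nat set \<times> nat set) set"
  let ?F = "magnitude_sets \<circ> set"
  have bij: "bij_betw ?F ?L ?P"
    using bij_betw_trans[OF bij_betw_strictly_decreasing_lists[OF inj_opart_key]
        bij_betw_magnitude_sets] .
  have fibre: "card {ps \<in> ?S. length (non_overlined ps) = r} =
      card {p \<in> odd_set_pairs r. pair_sum p = n}" for r
  proof -
    let ?Q = "{p \<in> odd_set_pairs r. pair_sum p = n}"
    have iff: "?cond ps \<and> length (non_overlined ps) = r \<longleftrightarrow> ?F ps \<in> ?Q" if ps: "ps \<in> ?L" for ps
    proof -
      have d: "distinct (non_overlined ps)" using ps overpartition_sorted_iff by blast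
      have "distinct (map opart_key ps)"
        using ps by (induction ps) auto
      then have "distinct ps" by (simp add: distinct_map)
      then have d': "distinct (overlined ps)"
        by (auto simp: overlined_def distinct_map inj_on_def prod_eq_iff)
      have pos: "\<forall>x\<in>set (map fst ps). 0 < x"
        if "\<forall>x\<in>set (non_overlined ps). odd x" "\<forall>x\<in>set (overlined ps). odd x"
      proof
        fix x assume "x \<in> set (map fst ps)"
        then have "x \<in> set (non_overlined ps) \<union> set (overlined ps)"
          by (auto simp: non_overlined_def overlined_def)
        then show "0 < x" using that by (auto intro: odd_pos)
      qed
      have lt: "int x \<le> 2 * int m - 1 \<longleftrightarrow> x < 2 * m" for x m by linarith
      have sums: "pair_sum (?F ps) = sum_list (map fst ps)"
        using d d' by (simp add: magnitude_sets_set pair_sum_def sum_list_map_fst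
            distinct_sum_list_conv_Sum)
      have sorted: "sorted_wrt (\<ge>) (map fst ps)"
        "\<forall>i j. i < j \<longrightarrow> j < length ps \<longrightarrow> snd (ps ! i) \<longrightarrow> fst (ps ! j) \<noteq> fst (ps ! i)"
        using ps overpartition_sorted_iff[of ps] by simp_all
      have over: "is_overpartition n ps \<longleftrightarrow>
          (\<forall>x\<in>set (map fst ps). 0 < x) \<and> sum_list (map fst ps) = n"
        using sorted unfolding is_overpartition_def is_partition_def by blast
      have "?F ps \<in> ?Q \<longleftrightarrow> length (non_overlined ps) = r \<and> (\<forall>x\<in>set (non_overlined ps). odd x) \<and>
          (\<forall>x\<in>set (overlined ps). odd x \<and> x < 2 * r) \<and> sum_list (map fst ps) = n"
        using sums by (auto simp: mem_odd_set_pairs_iff magnitude_sets_set distinct_card[OF d])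
      then show ?thesis using over d pos unfolding lt by blast
    qed
    have "ps \<in> ?L" if "?cond ps" for ps
      using that overpartition_sorted_iff[of ps]
      unfolding is_overpartition_def is_partition_def by simp
    then have S_eq: "{ps \<in> ?S. length (non_overlined ps) = r} = {ps \<in> ?L. ?F ps \<in> ?Q}"
      using iff by blast
    have "?Q \<subseteq> ?P" using odd_set_pairs_finite by auto
    also have "?P = ?F ` ?L" using bij by (simp only: bij_betw_def)
    finally have "?F ` {ps \<in> ?L. ?F ps \<in> ?Q} = ?Q" by blast
    then have "bij_betw ?F {ps \<in> ?S. length (non_overlined ps) = r} ?Q"
      unfolding S_eq by (rule bij_betw_subset[OF bij, rotated]) blast
    then show ?thesis by (rule bij_betw_same_card)
  qed
  have "GG1_over n = card ?S" by (simp add: GG1_over_def)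
  also have "\<dots> = (\<Sum>r\<le>n. card {ps \<in> ?S. length (non_overlined ps) = r})"
  proof (rule card_eq_sum_fibres)
    show "finite ?S"
      by (rule finite_subset[OF Collect_mono finite_overpartitions[of n]]) (intro impI, elim conjE)
    fix ps assume "ps \<in> ?S"
    then have "is_partition n (map fst ps)"
      unfolding mem_Collect_eq is_overpartition_def by (elim conjE)
    then have "length (map fst ps) \<le> n" by (rule length_le_if_is_partition)
    then show "length (non_overlined ps) \<le> n"
      using length_filter_le[of "\<lambda>p. \<not> snd p" ps] unfolding non_overlined_def length_map
      by linarith
  qed
  finally show ?thesis by (simp only: fibre card_odd_set_pairs)
qed

theorem theorem4p1:
  fixes n :: nat
  shows "GG1 n = GG1_over n"
  by (simp add: GG1_eq_sum GG1_over_eq_sum)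

end
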